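(* Let $\mathcal S$ be a small category equipped with an eventuality filter $\mathcal E=\{\mathcal E_s\}_{s\in\mathcal S}$, let $\mathcal C$ be a category with a terminal object $1$ and pullbacks, and let $X\colon\mathcal S\to\mathcal C$ be a functor (a categorical dynamical system). Let $\iota\colon\Delta I\Longrightarrow X$ be an invariant subsystem of $X$ equipped with a neighbourhood filter $\mathcal N_X(I)$. Let $\mathfrak R=(R,0,\{r_\lambda\colon R_\lambda\hookrightarrow R\}_{\lambda\in\Lambda},\le)$ be a Lyapunov measurement datum in $\mathcal C$, and let $L=\{L_s\colon X(s)\to R\}_{s\in\mathcal S}$ be a categorical Lyapunov function for $I$ with values in $\mathfrak R$. Let $s\in\mathcal S$ and $A\in\mathcal C$. If an $A$-generalised state $a\colon A\to X(s)$ has Lyapunov decay toward $I$, then $a$ converges to $I$.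
   Context: Constant functor: for $I\in\mathcal C$, $\Delta I\colon\mathcal S\to\mathcal C$ is the functor with value $I$ on every object and $\mathrm{id}_I$ on every morphism. Invariant subsystem: a pair $(I,\iota)$ with $I\in\mathcal C$ and $\iota\colon\Delta I\Longrightarrow X$ a natural transformation all of whose components $\iota_s\colon I\to X(s)$ are monomorphisms. Thus $X(\alpha)\circ\iota_s=\iota_t$ for every $\alpha\colon s\to t$ in $\mathcal S$. Generalised state: for $A\in\mathcal C$, an $A$-generalised state of $X$ over $s\in\mathcal S$ is a morphism $a\colon A\to X(s)$ in $\mathcal C$. Eventuality filter: for $s\in\mathcal S$ let $\operatorname{Out}(s)$ be the set of all morphisms of $\mathcal S$ with source $s$. A cosieve on $s$ is a subset $K\subseteq\operatorname{Out}(s)$ such that $\beta\circ\alpha\in K$ whenever $(\alpha\colon s\to t)\in K$ and $\beta\colon t\to u$ is a morphism of $\mathcal S$. An eventuality filter on $\mathcal S$ assigns to each $s\in\mathcal S$ a collection $\mathcal E_s$ of cosieves on $s$ (the eventual cosieves at $s$) such that (1) $\mathcal E_s$ is nonempty; (2) if $K\in\mathcal E_s$ and $K\subseteq K'$ with $K'$ a cosieve on $s$, then $K'\in\mathcal E_s$; (3) if $K,K'\in\mathcal E_s$, then $K\cap K'\in\mathcal E_s$; (4) $\varnothing\notin\mathcal E_s$. A property of morphisms with source $s$ holds eventually (from $s$) if there is $K\in\mathcal E_s$ such that every morphism in $K$ has the property. Stagewise neighbourhood of $I$ in $X$: a family of monomorphisms $U=(\mu_s\colon U_s\hookrightarrow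 X(s))_{s\in\mathcal S}$ such that for every $s\in\mathcal S$ the morphism $\iota_s$ factors through $\mu_s$. The collection of these is denoted $\mathsf{Nbd}_X(I)$. For stagewise neighbourhoods $U=(\mu_s\colon U_s\hookrightarrow X(s))_s$ and $V=(\nu_s\colon V_s\hookrightarrow X(s))_s$, write $U\le V$ if for every $s\in\mathcal S$ there is a morphism $\phi_s\colon U_s\to V_s$ with $\nu_s\circ\phi_s=\mu_s$. This is a preorder. Neighbourhood filter of $I$ in $X$: a collection $\mathcal N_X(I)\subseteq\mathsf{Nbd}_X(I)$ such that (1) $\mathcal N_X(I)$ is nonempty; (2) if $U\in\mathcal N_X(I)$, $V\in\mathsf{Nbd}_X(I)$ and $U\le V$, then $V\in\mathcal N_X(I)$; (3) if $U,V\in\mathcal N_X(I)$, then there is $W\in\mathcal N_X(I)$ with $W\le U$ and $W\le V$. Basis: a subcollection $\mathcal B\subseteq\mathcal N_X(I)$ is a basis for $\mathcal N_X(I)$ if for every $U\in\mathcal N_X(I)$ there is $V\in\mathcal B$ with $V\le U$. Lyapunov measurement datum in $\mathcal C$: a tuple $\mathfrak R=(R,0,\{r_\lambda\colon R_\lambda\hookrightarrow R\}_{\lambda\in\Lambda},\le)$ consisting of an object $R\in\mathcal C$; a morphism $0\colon 1\to R$; a family of monomorphisms $r_\lambda\colon R_\lambda\hookrightarrow R$ indexed by some $\Lambda$; and, for every object $Y\in\mathcal C$, a preorder $\le$ on $\operatorname{Hom}_{\mathcal C}(Y,R)$, these preorders being preserved by precomposition (if $h\le k\colon Y\to R$ and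 $f\colon Z\to Y$, then $h\circ f\le k\circ f$). It is required that (i) $0\colon 1\to R$ factors through $r_\lambda$ for every $\lambda\in\Lambda$; (ii) for every $\lambda\in\Lambda$ and all $h\le k\colon Y\to R$, if $k$ factors through $r_\lambda$ then $h$ factors through $r_\lambda$. Categorical Lyapunov function for $I$ with values in $\mathfrak R$ (where $I$ carries $\mathcal N_X(I)$): a family of morphisms $L_s\colon X(s)\to R$, $s\in\mathcal S$ (no naturality is required), such that (1) $L_s\circ\iota_s=0\circ{!}_I$ for every $s\in\mathcal S$, where ${!}_I\colon I\to 1$ is the unique morphism; (2) $L_t\circ X(\alpha)\le L_s$ in $\operatorname{Hom}_{\mathcal C}(X(s),R)$ for every morphism $\alpha\colon s\to t$ in $\mathcal S$; (3) the sublevel stagewise neighbourhoods $U^\lambda=(U^\lambda_s\hookrightarrow X(s))_{s\in\mathcal S}$, $\lambda\in\Lambda$, form a basis for $\mathcal N_X(I)$ (in particular they belong to $\mathcal N_X(I)$). Here $U^\lambda_s:=X(s)\times_R R_\lambda$ is the pullback of $r_\lambda$ along $L_s$, and $U^\lambda_s\hookrightarrow X(s)$ is the pullback projection. This projection is a monomorphism, and by (1) and (i) the morphism $\iota_s$ factors through it, so $U^\lambda$ is a stagewise neighbourhood of $I$. Lyapunov decay: $a\colon A\to X(s)$ has Lyapunov decay toward $I$ if for every $\lambda\in\Lambda$ the following property of morphisms $\alpha\colon s\to t$ with source $s$ holds eventually: the composite $L_t\circ X(\alpha)\circ a\colon A\to R$ factors through $r_\lambda\colon R_\lambda\hookrightarrow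 R$. Convergence: $a\colon A\to X(s)$ converges to $I$ if for every $U=(\mu_t\colon U_t\hookrightarrow X(t))_{t\in\mathcal S}\in\mathcal N_X(I)$ the following property of morphisms $\alpha\colon s\to t$ with source $s$ holds eventually: the composite $X(\alpha)\circ a\colon A\to X(t)$ factors through $\mu_t\colon U_t\hookrightarrow X(t)$. *)

theory Defs
  imports Main "HOL-Library.FuncSet"
begin

section \<open>Categories\<close>

record ('o, 'm) cat =
  Obj :: "'o set"
  Arr :: "'m set"
  Dom :: "'m \<Rightarrow> 'o"
  Cod :: "'m \<Rightarrow> 'o"
  Ide :: "'o \<Rightarrow> 'm"
  Comp :: "'m \<Rightarrow> 'm \<Rightarrow> 'm"  (infixl \<open>\<cdot>\<index>\<close> 70)

definition Hom :: "('o, 'm) cat \<Rightarrow> 'o \<Rightarrow> 'o \<Rightarrow> 'm set" where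
  "Hom C a b = {f \<in> Arr C. Dom C f = a \<and> Cod C f = b}"

text \<open>Composition is written in applicative order and is constrained only on composable pairs.\<close>

locale category =
  fixes C :: "('o, 'm) cat" (structure)
  assumes Dom_in_Obj: "f \<in> Arr C \<Longrightarrow> Dom C f \<in> Obj C"
    and Cod_in_Obj: "f \<in> Arr C \<Longrightarrow> Cod C f \<in> Obj C"
    and Ide_in_Hom: "a \<in> Obj C \<Longrightarrow> Ide C a \<in> Hom C a a"
    and Comp_in_Hom: "\<lbrakk>f \<in> Hom C a b; g \<in> Hom C b c\<rbrakk> \<Longrightarrow> g \<cdot> f \<in> Hom C a c"
    and Comp_Ide: "f \<in> Hom C a b \<Longrightarrow> f \<cdot> Ide C a = f"
    and Ide_Comp: "f \<in> Hom C a b \<Longrightarrow> Ide C b \<cdot> f = f"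
    and Comp_assoc:
      "\<lbrakk>f \<in> Hom C a b; g \<in> Hom C b c; h \<in> Hom C c d\<rbrakk> \<Longrightarrow> (h \<cdot> g) \<cdot> f = h \<cdot> (g \<cdot> f)"

definition monic :: "('o, 'm) cat \<Rightarrow> 'm \<Rightarrow> bool" where
  "monic C m \<longleftrightarrow> m \<in> Arr C \<and>
     (\<forall>Y \<in> Obj C. \<forall>f \<in> Hom C Y (Dom C m). \<forall>g \<in> Hom C Y (Dom C m).
        m \<cdot>\<^bsub>C\<^esub> f = m \<cdot>\<^bsub>C\<^esub> g \<longrightarrow> f = g)"

definition factors_through :: "('o, 'm) cat \<Rightarrow> 'm \<Rightarrow> 'm \<Rightarrow> bool" where
  "factors_through C f m \<longleftrightarrow> (\<exists>g \<in> Hom C (Dom C f) (Dom C m). m \<cdot>\<^bsub>C\<^esub> g = f)"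

definition is_terminal :: "('o, 'm) cat \<Rightarrow> 'o \<Rightarrow> bool" where
  "is_terminal C one \<longleftrightarrow> one \<in> Obj C \<and> (\<forall>Y \<in> Obj C. \<exists>!f. f \<in> Hom C Y one)"

definition to_terminal :: "('o, 'm) cat \<Rightarrow> 'o \<Rightarrow> 'o \<Rightarrow> 'm" where
  "to_terminal C one Y = (THE f. f \<in> Hom C Y one)"

definition is_pullback :: "('o, 'm) cat \<Rightarrow> 'm \<Rightarrow> 'm \<Rightarrow> 'm \<Rightarrow> 'm \<Rightarrow> bool" where
  "is_pullback C f g p q \<longleftrightarrow>
     f \<in> Arr C \<and> g \<in> Arr C \<and> Cod C f = Cod C g \<and>
     p \<in> Arr C \<and> q \<in> Arr C \<and> Dom C p = Dom C q \<and>
     Cod C p = Dom C f \<and> Cod C q = Dom C g \<and>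
     f \<cdot>\<^bsub>C\<^esub> p = g \<cdot>\<^bsub>C\<^esub> q \<and>
     (\<forall>Y \<in> Obj C. \<forall>h \<in> Hom C Y (Dom C f). \<forall>k \<in> Hom C Y (Dom C g).
        f \<cdot>\<^bsub>C\<^esub> h = g \<cdot>\<^bsub>C\<^esub> k \<longrightarrow>
        (\<exists>!u. u \<in> Hom C Y (Dom C p) \<and> p \<cdot>\<^bsub>C\<^esub> u = h \<and> q \<cdot>\<^bsub>C\<^esub> u = k))"

definition has_pullbacks :: "('o, 'm) cat \<Rightarrow> bool" where
  "has_pullbacks C \<longleftrightarrow>
     (\<forall>f \<in> Arr C. \<forall>g \<in> Arr C. Cod C f = Cod C g \<longrightarrow> (\<exists>p q. is_pullback C f g p q))"

text \<open>
  The projection of a chosen pullback of \<open>f\<close> and \<open>g\<close> to the domain of \<open>f\<close>, i.e. the pullback of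
  \<open>g\<close> along \<open>f\<close>. It is determined only up to isomorphism over \<open>Dom C f\<close>; it is used below only to
  form stagewise neighbourhoods, and neighbourhood filters are closed under isomorphism of these.
\<close>
definition pullback_along :: "('o, 'm) cat \<Rightarrow> 'm \<Rightarrow> 'm \<Rightarrow> 'm" where
  "pullback_along C f g = (SOME p. \<exists>q. is_pullback C f g p q)"

record ('a, 'm, 'b, 'n) ftor =
  omap :: "'a \<Rightarrow> 'b"
  amap :: "'m \<Rightarrow> 'n"

definition is_functor ::
  "('a, 'm) cat \<Rightarrow> ('b, 'n) cat \<Rightarrow> ('a, 'm, 'b, 'n) ftor \<Rightarrow> bool" where
  "is_functor S C F \<longleftrightarrow>
     (\<forall>s \<in> Obj S. omap F s \<in> Obj C) \<and>
     (\<forall>s \<in> Obj S. \<forall>t \<in> Obj S. \<forall>\<alpha> \<in> Hom S s t. amap F \<alpha> \<in> Hom C (omap F s) (omap F t)) \<and>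
     (\<forall>s \<in> Obj S. amap F (Ide S s) = Ide C (omap F s)) \<and>
     (\<forall>s \<in> Obj S. \<forall>t \<in> Obj S. \<forall>u \<in> Obj S. \<forall>\<alpha> \<in> Hom S s t. \<forall>\<beta> \<in> Hom S t u.
        amap F (\<beta> \<cdot>\<^bsub>S\<^esub> \<alpha>) = amap F \<beta> \<cdot>\<^bsub>C\<^esub> amap F \<alpha>)"

definition const_functor :: "('b, 'n) cat \<Rightarrow> 'b \<Rightarrow> ('a, 'm, 'b, 'n) ftor" where
  "const_functor C I = \<lparr>omap = (\<lambda>_. I), amap = (\<lambda>_. Ide C I)\<rparr>"

definition natural_transformation ::
  "('a, 'm) cat \<Rightarrow> ('b, 'n) cat \<Rightarrow> ('a, 'm, 'b, 'n) ftor \<Rightarrow> ('a, 'm, 'b, 'n) ftor \<Rightarrow>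
   ('a \<Rightarrow> 'n) \<Rightarrow> bool" where
  "natural_transformation S C F G \<tau> \<longleftrightarrow>
     (\<forall>s \<in> Obj S. \<tau> s \<in> Hom C (omap F s) (omap G s)) \<and>
     (\<forall>s \<in> Obj S. \<forall>t \<in> Obj S. \<forall>\<alpha> \<in> Hom S s t.
        amap G \<alpha> \<cdot>\<^bsub>C\<^esub> \<tau> s = \<tau> t \<cdot>\<^bsub>C\<^esub> amap F \<alpha>)"


section \<open>Invariant subsystems and eventuality filters\<close>

definition invariant_subsystem ::
  "('a, 'm) cat \<Rightarrow> ('b, 'n) cat \<Rightarrow> ('a, 'm, 'b, 'n) ftor \<Rightarrow> 'b \<Rightarrow> ('a \<Rightarrow> 'n) \<Rightarrow> bool" where
  "invariant_subsystem S C X I \<iota> \<longleftrightarrow>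
     I \<in> Obj C \<and> natural_transformation S C (const_functor C I) X \<iota> \<and>
     (\<forall>s \<in> Obj S. monic C (\<iota> s))"

definition Out :: "('a, 'm) cat \<Rightarrow> 'a \<Rightarrow> 'm set" where
  "Out S s = {\<alpha> \<in> Arr S. Dom S \<alpha> = s}"

definition cosieve :: "('a, 'm) cat \<Rightarrow> 'a \<Rightarrow> 'm set \<Rightarrow> bool" where
  "cosieve S s K \<longleftrightarrow>
     K \<subseteq> Out S s \<and> (\<forall>\<alpha> \<in> K. \<forall>\<beta> \<in> Out S (Cod S \<alpha>). \<beta> \<cdot>\<^bsub>S\<^esub> \<alpha> \<in> K)"

definition eventuality_filter :: "('a, 'm) cat \<Rightarrow> ('a \<Rightarrow> 'm set set) \<Rightarrow> bool" where
  "eventuality_filter S E \<longleftrightarrow>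
     (\<forall>s \<in> Obj S.
        E s \<subseteq> Collect (cosieve S s) \<and>
        E s \<noteq> {} \<and>
        (\<forall>K \<in> E s. \<forall>K'. cosieve S s K' \<and> K \<subseteq> K' \<longrightarrow> K' \<in> E s) \<and>
        (\<forall>K \<in> E s. \<forall>K' \<in> E s. K \<inter> K' \<in> E s) \<and>
        {} \<notin> E s)"

definition eventually_from :: "('a \<Rightarrow> 'm set set) \<Rightarrow> 'a \<Rightarrow> ('m \<Rightarrow> bool) \<Rightarrow> bool" where
  "eventually_from E s P \<longleftrightarrow> (\<exists>K \<in> E s. \<forall>\<alpha> \<in> K. P \<alpha>)"


section \<open>Stagewise neighbourhoods\<close>

text \<open>
  A stagewise neighbourhood is represented by the family of its monomorphisms, the objects \<open>U\<^sub>s\<close>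
  being their domains. Families indexed by \<open>Obj S\<close> are extensional functions, so that distinct
  functions represent distinct families.
\<close>
definition Nbd ::
  "('a, 'm) cat \<Rightarrow> ('b, 'n) cat \<Rightarrow> ('a, 'm, 'b, 'n) ftor \<Rightarrow> ('a \<Rightarrow> 'n) \<Rightarrow> ('a \<Rightarrow> 'n) set" where
  "Nbd S C X \<iota> =
     {\<mu> \<in> extensional (Obj S). \<forall>s \<in> Obj S.
        monic C (\<mu> s) \<and> Cod C (\<mu> s) = omap X s \<and> factors_through C (\<iota> s) (\<mu> s)}"

definition nbd_le :: "('a, 'm) cat \<Rightarrow> ('b, 'n) cat \<Rightarrow> ('a \<Rightarrow> 'n) \<Rightarrow> ('a \<Rightarrow> 'n) \<Rightarrow> bool" where
  "nbd_le S C \<mu> \<nu> \<longleftrightarrow>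
     (\<forall>s \<in> Obj S. \<exists>\<phi> \<in> Hom C (Dom C (\<mu> s)) (Dom C (\<nu> s)). \<nu> s \<cdot>\<^bsub>C\<^esub> \<phi> = \<mu> s)"

definition neighbourhood_filter ::
  "('a, 'm) cat \<Rightarrow> ('b, 'n) cat \<Rightarrow> ('a, 'm, 'b, 'n) ftor \<Rightarrow> ('a \<Rightarrow> 'n) \<Rightarrow> ('a \<Rightarrow> 'n) set \<Rightarrow> bool" where
  "neighbourhood_filter S C X \<iota> N \<longleftrightarrow>
     N \<subseteq> Nbd S C X \<iota> \<and>
     N \<noteq> {} \<and>
     (\<forall>U \<in> N. \<forall>V \<in> Nbd S C X \<iota>. nbd_le S C U V \<longrightarrow> V \<in> N) \<and>
     (\<forall>U \<in> N. \<forall>V \<in> N. \<exists>W \<in> N. nbd_le S C W U \<and> nbd_le S C W V)"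

definition nbd_basis ::
  "('a, 'm) cat \<Rightarrow> ('b, 'n) cat \<Rightarrow> ('a \<Rightarrow> 'n) set \<Rightarrow> ('a \<Rightarrow> 'n) set \<Rightarrow> bool" where
  "nbd_basis S C N B \<longleftrightarrow> B \<subseteq> N \<and> (\<forall>U \<in> N. \<exists>V \<in> B. nbd_le S C V U)"


section \<open>Lyapunov functions\<close>

text \<open>
  \<open>incl\<close> is the family of monomorphisms \<open>r\<^sub>\<lambda>\<close>, whose domains are the objects \<open>R\<^sub>\<lambda>\<close>;
  \<open>ord Y\<close> is the preorder on the morphisms from \<open>Y\<close> to \<open>val\<close>, as a set of pairs.
\<close>
record ('b, 'n, 'l) measurement =
  val :: 'b
  zero_pt :: 'n
  index :: "'l set"
  incl :: "'l \<Rightarrow> 'n"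
  ord :: "'b \<Rightarrow> 'n rel"

definition measurement_datum ::
  "('b, 'n) cat \<Rightarrow> 'b \<Rightarrow> ('b, 'n, 'l) measurement \<Rightarrow> bool" where
  "measurement_datum C one R \<longleftrightarrow>
     val R \<in> Obj C \<and>
     zero_pt R \<in> Hom C one (val R) \<and>
     (\<forall>l \<in> index R. monic C (incl R l) \<and> Cod C (incl R l) = val R) \<and>
     (\<forall>Y \<in> Obj C. preorder_on (Hom C Y (val R)) (ord R Y)) \<and>
     (\<forall>Y \<in> Obj C. \<forall>Z \<in> Obj C. \<forall>(h, k) \<in> ord R Y. \<forall>f \<in> Hom C Z Y.
        (h \<cdot>\<^bsub>C\<^esub> f, k \<cdot>\<^bsub>C\<^esub> f) \<in> ord R Z) \<and>
     (\<forall>l \<in> index R. factors_through C (zero_pt R) (incl R l)) \<and>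
     (\<forall>l \<in> index R. \<forall>Y \<in> Obj C. \<forall>(h, k) \<in> ord R Y.
        factors_through C k (incl R l) \<longrightarrow> factors_through C h (incl R l))"

definition sublevel_nbd ::
  "('a, 'm) cat \<Rightarrow> ('b, 'n) cat \<Rightarrow> ('b, 'n, 'l) measurement \<Rightarrow> ('a \<Rightarrow> 'n) \<Rightarrow> 'l \<Rightarrow> 'a \<Rightarrow> 'n" where
  "sublevel_nbd S C R L l = (\<lambda>s \<in> Obj S. pullback_along C (L s) (incl R l))"

definition lyapunov_function ::
  "('a, 'm) cat \<Rightarrow> ('b, 'n) cat \<Rightarrow> 'b \<Rightarrow> ('a, 'm, 'b, 'n) ftor \<Rightarrow> 'b \<Rightarrow> ('a \<Rightarrow> 'n) \<Rightarrow>
   ('a \<Rightarrow> 'n) set \<Rightarrow> ('b, 'n, 'l) measurement \<Rightarrow> ('a \<Rightarrow> 'n) \<Rightarrow> bool" where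
  "lyapunov_function S C one X I \<iota> N R L \<longleftrightarrow>
     (\<forall>s \<in> Obj S. L s \<in> Hom C (omap X s) (val R)) \<and>
     (\<forall>s \<in> Obj S. L s \<cdot>\<^bsub>C\<^esub> \<iota> s = zero_pt R \<cdot>\<^bsub>C\<^esub> to_terminal C one I) \<and>
     (\<forall>s \<in> Obj S. \<forall>t \<in> Obj S. \<forall>\<alpha> \<in> Hom S s t.
        (L t \<cdot>\<^bsub>C\<^esub> amap X \<alpha>, L s) \<in> ord R (omap X s)) \<and>
     nbd_basis S C N (sublevel_nbd S C R L ` index R)"

definition lyapunov_decay ::
  "('a, 'm) cat \<Rightarrow> ('a \<Rightarrow> 'm set set) \<Rightarrow> ('b, 'n) cat \<Rightarrow> ('a, 'm, 'b, 'n) ftor \<Rightarrow>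
   ('b, 'n, 'l) measurement \<Rightarrow> ('a \<Rightarrow> 'n) \<Rightarrow> 'a \<Rightarrow> 'n \<Rightarrow> bool" where
  "lyapunov_decay S E C X R L s a \<longleftrightarrow>
     (\<forall>l \<in> index R. eventually_from E s
        (\<lambda>\<alpha>. factors_through C (L (Cod S \<alpha>) \<cdot>\<^bsub>C\<^esub> amap X \<alpha> \<cdot>\<^bsub>C\<^esub> a) (incl R l)))"

definition converges_to ::
  "('a, 'm) cat \<Rightarrow> ('a \<Rightarrow> 'm set set) \<Rightarrow> ('b, 'n) cat \<Rightarrow> ('a, 'm, 'b, 'n) ftor \<Rightarrow>
   ('a \<Rightarrow> 'n) set \<Rightarrow> 'a \<Rightarrow> 'n \<Rightarrow> bool" where
  "converges_to S E C X N s a \<longleftrightarrow>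
     (\<forall>U \<in> N. eventually_from E s
        (\<lambda>\<alpha>. factors_through C (amap X \<alpha> \<cdot>\<^bsub>C\<^esub> a) (U (Cod S \<alpha>))))"

end

theory Submission
  imports Defs
begin

text \<open>
  Along any \<open>\<alpha> : s \<rightarrow> t\<close>, the universal property of the pullback turns a factorisation of
  \<open>L\<^sub>t \<circ> X(\<alpha>) \<circ> a\<close> through \<open>r\<^sub>\<lambda>\<close> into one of \<open>X(\<alpha>) \<circ> a\<close> through \<open>U\<^sup>\<lambda>\<^sub>t\<close>. Hence decay is
  eventual membership in every sublevel neighbourhood, and these form a basis.
\<close>

lemma (in category) factors_through_pullback:
  assumes "is_pullback C f g p q" and h: "h \<in> Hom C Y (Dom C f)"
    and "factors_through C (f \<cdot> h) g"
  shows "factors_through C h p"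
proof -
  have f: "f \<in> Hom C (Dom C f) (Cod C f)"
    using assms(1) by (simp add: is_pullback_def Hom_def)
  have Y: "Y \<in> Obj C" and "Dom C h = Y"
    using h Dom_in_Obj by (auto simp: Hom_def)
  moreover have "Dom C (f \<cdot> h) = Y"
    using Comp_in_Hom[OF h f] by (simp add: Hom_def)
  ultimately obtain k where "k \<in> Hom C Y (Dom C g)" "f \<cdot> h = g \<cdot> k"
    using assms(3) by (auto simp: factors_through_def)
  \<comment> \<open>The pair \<open>(h, k)\<close> is a cone over the cospan \<open>(f, g)\<close>;
    \<open>u\<close> is its mediating arrow.\<close>
  then obtain u where "u \<in> Hom C Y (Dom C p)" "p \<cdot> u = h"
    using assms(1) Y h unfolding is_pullback_def by blast
  then show ?thesis
    using \<open>Dom C h = Y\<close> by (auto simp: factors_through_def)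
qed

text \<open>\<open>pullback_along\<close> chooses one projection only, so the other is recovered as
  a mere existence; \<open>has_pullbacks\<close> guarantees that the choice predicate is
  satisfiable.\<close>

lemma is_pullback_pullback_along:
  assumes "has_pullbacks C" "f \<in> Arr C" "g \<in> Arr C" "Cod C f = Cod C g"
  obtains q where "is_pullback C f g (pullback_along C f g) q"
proof -
  have "\<exists>p q. is_pullback C f g p q"
    using assms by (simp add: has_pullbacks_def)
  then have "\<exists>q. is_pullback C f g (pullback_along C f g) q"
    unfolding pullback_along_def by (rule someI_ex)
  then show thesis using that by blast
qed

text \<open>Postcomposing the factor of \<open>h\<close> with \<phi> gives the new factor. This
  carries membership in a sublevel neighbourhood over to a larger neighbourhood. Since
  \<open>Comp_assoc\<close> speaks of hom-sets, \<open>n\<close> has to be an arrow.\<close>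

lemma (in category) factors_through_trans:
  assumes "factors_through C h m" and \<phi>: "\<phi> \<in> Hom C (Dom C m) (Dom C n)"
    and "n \<cdot> \<phi> = m" and "n \<in> Arr C"
  shows "factors_through C h n"
proof -
  obtain g where g: "g \<in> Hom C (Dom C h) (Dom C m)" "m \<cdot> g = h"
    using assms(1) by (auto simp: factors_through_def)
  have n: "n \<in> Hom C (Dom C n) (Cod C n)"
    using \<open>n \<in> Arr C\<close> by (simp add: Hom_def)
  have "n \<cdot> (\<phi> \<cdot> g) = h"
    using Comp_assoc[OF g(1) \<phi> n] g(2) \<open>n \<cdot> \<phi> = m\<close> by simp
  then show ?thesis
    using Comp_in_Hom[OF g(1) \<phi>] by (auto simp: factors_through_def)
qed

theorem theorem4p11:
  fixes S :: "('a, 'm) cat" and C :: "('b, 'n) cat"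
    and E :: "'a \<Rightarrow> 'm set set"
    and one :: 'b
    and X :: "('a, 'm, 'b, 'n) ftor"
    and I :: 'b and \<iota> :: "'a \<Rightarrow> 'n"
    and N :: "('a \<Rightarrow> 'n) set"
    and R :: "('b, 'n, 'l) measurement"
    and L :: "'a \<Rightarrow> 'n"
    and s :: 'a and A :: 'b and a :: 'n
  assumes "category S" and "eventuality_filter S E"
    and "category C" and "is_terminal C one" and "has_pullbacks C"
    and "is_functor S C X"
    and "invariant_subsystem S C X I \<iota>"
    and "neighbourhood_filter S C X \<iota> N"
    and "measurement_datum C one R"
    and "lyapunov_function S C one X I \<iota> N R L"
    and "s \<in> Obj S" and "A \<in> Obj C" and "a \<in> Hom C A (omap X s)"
    and "lyapunov_decay S E C X R L s a"
  shows "converges_to S E C X N s a"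
  unfolding converges_to_def
proof
  fix U assume U: "U \<in> N"
  have L: "\<And>t. t \<in> Obj S \<Longrightarrow> L t \<in> Hom C (omap X t) (val R)"
    and basis: "nbd_basis S C N (sublevel_nbd S C R L ` index R)"
    using \<open>lyapunov_function S C one X I \<iota> N R L\<close> by (simp_all add: lyapunov_function_def)
  \<comment> \<open>The index \<open>l\<close> depends on \<open>U\<close> alone, so decay at this
    single level yields one cosieve \<open>K\<close> that serves all stages.\<close>
  obtain l where l: "l \<in> index R" and le: "nbd_le S C (sublevel_nbd S C R L l) U"
    using basis U by (auto simp: nbd_basis_def)
  have r: "incl R l \<in> Arr C" "Cod C (incl R l) = val R"
    using \<open>measurement_datum C one R\<close> l by (auto simp: measurement_datum_def monic_def)
  obtain K where K: "K \<in> E s"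
    and decay: "\<And>\<alpha>. \<alpha> \<in> K \<Longrightarrow>
      factors_through C (L (Cod S \<alpha>) \<cdot>\<^bsub>C\<^esub> amap X \<alpha> \<cdot>\<^bsub>C\<^esub> a) (incl R l)"
    using \<open>lyapunov_decay S E C X R L s a\<close> l
    unfolding lyapunov_decay_def eventually_from_def by blast
  have "factors_through C (amap X \<alpha> \<cdot>\<^bsub>C\<^esub> a) (U (Cod S \<alpha>))" if "\<alpha> \<in> K" for \<alpha>
  proof -
    define t where "t = Cod S \<alpha>"
    \<comment> \<open>Being a cosieve on \<open>s\<close> makes every member of \<open>K\<close> an
      arrow with source \<open>s\<close>.\<close>
    have "cosieve S s K"
      using \<open>eventuality_filter S E\<close> \<open>s \<in> Obj S\<close> K by (auto simp: eventuality_filter_def)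
    then have \<alpha>: "\<alpha> \<in> Hom S s t"
      using \<open>\<alpha> \<in> K\<close> by (auto simp: cosieve_def Out_def Hom_def t_def)
    then have t: "t \<in> Obj S"
      using category.Cod_in_Obj[OF \<open>category S\<close>] by (auto simp: Hom_def)
    have X\<alpha>: "amap X \<alpha> \<in> Hom C (omap X s) (omap X t)"
      using \<open>is_functor S C X\<close> \<open>s \<in> Obj S\<close> t \<alpha> by (simp add: is_functor_def)
    have Lt: "L t \<in> Arr C" "Dom C (L t) = omap X t" "Cod C (L t) = val R"
      using L[OF t] by (simp_all add: Hom_def)
    obtain q where "is_pullback C (L t) (incl R l) (pullback_along C (L t) (incl R l)) q"
      using is_pullback_pullback_along \<open>has_pullbacks C\<close> Lt r by metis
    moreover have "amap X \<alpha> \<cdot>\<^bsub>C\<^esub> a \<in> Hom C A (Dom C (L t))"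
      using category.Comp_in_Hom[OF \<open>category C\<close> \<open>a \<in> Hom C A (omap X s)\<close> X\<alpha>] Lt by simp
    \<comment> \<open>Composition associates to the left, so the decay hypothesis speaks of
      \<open>(L t \<cdot> amap X \<alpha>) \<cdot> a\<close>; rebracketing exhibits
      \<open>L t\<close> as the leg along which the pullback is taken.\<close>
    moreover have "factors_through C (L t \<cdot>\<^bsub>C\<^esub> (amap X \<alpha> \<cdot>\<^bsub>C\<^esub> a)) (incl R l)"
      using decay[OF \<open>\<alpha> \<in> K\<close>]
        category.Comp_assoc[OF \<open>category C\<close> \<open>a \<in> Hom C A (omap X s)\<close> X\<alpha> L[OF t]]
      by (simp add: t_def)
    ultimately have "factors_through C (amap X \<alpha> \<cdot>\<^bsub>C\<^esub> a) (sublevel_nbd S C R L l t)"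
      using category.factors_through_pullback[OF \<open>category C\<close>] t
      by (simp add: sublevel_nbd_def)
    \<comment> \<open>The component at \<open>t\<close> of the comparison of the sublevel
      neighbourhood with \<open>U\<close>.\<close>
    moreover obtain \<phi> where
      "\<phi> \<in> Hom C (Dom C (sublevel_nbd S C R L l t)) (Dom C (U t))"
      "U t \<cdot>\<^bsub>C\<^esub> \<phi> = sublevel_nbd S C R L l t"
      using le t by (auto simp: nbd_le_def)
    moreover have "U t \<in> Arr C"
      using \<open>neighbourhood_filter S C X \<iota> N\<close> U t
      by (auto simp: neighbourhood_filter_def Nbd_def monic_def)
    ultimately show ?thesis
      using category.factors_through_trans[OF \<open>category C\<close>] by (simp add: t_def)
  qed
  then show "eventually_from E s
      (\<lambda>\<alpha>. factors_through C (amap X \<alpha> \<cdot>\<^bsub>C\<^esub> a) (U (Cod S \<alpha>)))"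
    using K by (auto simp: eventually_from_def)
qed

end
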